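(* Let $A=(a_{ij})$ be an $l\times l$ complex matrix, $\lambda=(\lambda_1,\ldots,\lambda_l)\in\mathbb{C}^l$ and $\mathbf{d}=(d_1,\ldots,d_l)$ positive integers. Let $M(A,\lambda,\mathbf d)=(a_{ij}J_{d_id_j})_{1\leq i,j\leq l}+\mathrm{diag}(\lambda_1I_{d_1},\ldots,\lambda_lI_{d_l})$ (a square matrix of size $d_1+\cdots+d_l$) and $\bar M(A,\lambda,\mathbf d)=\mathrm{diag}(d_1,\ldots,d_l)A+\mathrm{diag}(\lambda_1,\ldots,\lambda_l)$. Then $$\chi_{M(A,\lambda,\mathbf d)}(t)=\chi_{\bar M(A,\lambda,\mathbf d)}(t)\prod_{i=1}^l(t-\lambda_i)^{d_i-1},\qquad \det M(A,\lambda,\mathbf d)=\det\bar M(A,\lambda,\mathbf d)\prod_{i=1}^l\lambda_i^{d_i-1}.$$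
   Context: $J_{pq}$ is the $p\times q$ all-ones matrix, $I_p$ the identity matrix, $\mathrm{diag}$ a (block) diagonal matrix, and $\chi_X(t)=\det(tI-X)$. *)

theory Defs
  imports "Jordan_Normal_Form.Char_Poly" Complex_Main
begin

definition all_ones_mat :: "nat \<Rightarrow> nat \<Rightarrow> 'a :: one mat" where
  "all_ones_mat p q = mat p q (\<lambda>_. 1)"

definition block_offset :: "nat vec \<Rightarrow> nat \<Rightarrow> nat" where
  "block_offset d i = (\<Sum>j<i. d $ j)"

text \<open>Global rows (and columns) are numbered from 0; block \<open>i\<close> consists of the positions \<open>k\<close>
  with \<open>block_offset d i \<le> k < block_offset d (i + 1)\<close>.\<close>

definition block_index :: "nat vec \<Rightarrow> nat \<Rightarrow> nat" where
  "block_index d k = (LEAST i. k < block_offset d (Suc i))"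

text \<open>The matrix \<open>(B i j)\<close>, \<open>0 \<le> i, j < dim_vec d\<close>, assembled from blocks \<open>B i j\<close> of
  size \<open>d $ i\<close> by \<open>d $ j\<close>.\<close>

definition block_mat :: "nat vec \<Rightarrow> (nat \<Rightarrow> nat \<Rightarrow> 'a mat) \<Rightarrow> 'a mat" where
  "block_mat d B = (let n = block_offset d (dim_vec d) in
     mat n n (\<lambda>(r, c). let i = block_index d r; j = block_index d c in
       B i j $$ (r - block_offset d i, c - block_offset d j)))"

definition M_mat :: "complex mat \<Rightarrow> complex vec \<Rightarrow> nat vec \<Rightarrow> complex mat" where
  "M_mat A lam d =
     block_mat d (\<lambda>i j. A $$ (i, j) \<cdot>\<^sub>m all_ones_mat (d $ i) (d $ j))
     + diag_block_mat (map (\<lambda>i. lam $ i \<cdot>\<^sub>m 1\<^sub>m (d $ i)) [0..<dim_vec d])"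

definition M_bar :: "complex mat \<Rightarrow> complex vec \<Rightarrow> nat vec \<Rightarrow> complex mat" where
  "M_bar A lam d =
     mat_diag (dim_vec d) (\<lambda>i. of_nat (d $ i)) * A + mat_diag (dim_vec d) (\<lambda>i. lam $ i)"

lemma block_offset_mono: "i \<le> j \<Longrightarrow> block_offset d i \<le> block_offset d j"
  unfolding block_offset_def by (rule sum_mono2) auto

lemma block_index_offset_add:
  assumes "r < d $ i"
  shows "block_index d (block_offset d i + r) = i"
  unfolding block_index_def
proof (rule Least_equality)
  show "block_offset d i + r < block_offset d (Suc i)"
    using assms by (simp add: block_offset_def)
next
  fix k assume k: "block_offset d i + r < block_offset d (Suc k)"
  show "i \<le> k"
  proof (rule ccontr)
    assume "\<not> i \<le> k"
    then have "block_offset d (Suc k) \<le> block_offset d i"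
      by (intro block_offset_mono) simp
    with k show False by simp
  qed
qed

lemma block_offset_add_less:
  assumes "r < d $ i" "i < dim_vec d"
  shows "block_offset d i + r < block_offset d (dim_vec d)"
proof -
  have "block_offset d i + r < block_offset d (Suc i)"
    using assms by (simp add: block_offset_def)
  also have "\<dots> \<le> block_offset d (dim_vec d)"
    using assms by (intro block_offset_mono) simp
  finally show ?thesis .
qed

lemma block_mat_index:
  assumes "i < dim_vec d" "j < dim_vec d" "r < d $ i" "c < d $ j"
  shows "block_mat d B $$ (block_offset d i + r, block_offset d j + c) = B i j $$ (r, c)"
  using assms
  by (simp add: block_mat_def Let_def block_index_offset_add block_offset_add_less)

lemma M_mat_carrier:
  "M_mat A lam d \<in> carrier_mat (\<Sum>i<dim_vec d. d $ i) (\<Sum>i<dim_vec d. d $ i)"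
  unfolding M_mat_def
  by (rule carrier_matI)
    (simp_all add: dim_diag_block_mat o_def interv_sum_list_conv_sum_set_nat atLeast0LessThan)

end

theory Submission
  imports Defs
begin

text \<open>Let \<open>Q\<close> be the \<open>l \<times> n\<close> incidence matrix of the blocks, \<open>C = Q\<^sup>T A\<close>, and let \<open>D\<close> and
  \<open>\<Lambda>\<close> be the diagonal matrices carrying the \<open>\<lambda>\<^sub>i\<close> with multiplicity \<open>d\<^sub>i\<close> and \<open>1\<close>. Then
  \<open>M = D + C Q\<close>, \<open>M_bar = \<Lambda> + Q C\<close> and \<open>Q D = \<Lambda> Q\<close>. Reducing the bordered matrix
  \<open>(X, C; Q, 1)\<close> with \<open>X = t - D\<close> to triangular form in two ways yields
  \<open>det (t - \<Lambda>) det (t - M) = det (t - D) det (t - M_bar)\<close> without inverting \<open>t - D\<close>; as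
  an identity of polynomials in \<open>t\<close>, the factor \<open>det (t - \<Lambda>)\<close> can be cancelled. The determinant
  formula is the case \<open>t = 0\<close>.\<close>

section \<open>Determinants and characteristic polynomials under an intertwining relation\<close>

text \<open>For identity matrices \<open>X\<close> and \<open>Y\<close> this is Sylvester's identity
  \<open>det (1 - C Q) = det (1 - Q C)\<close>; the relation \<open>Q X = Y Q\<close> extends it to
  other diagonal blocks.\<close>

lemma det_intertwine:
  fixes X :: "'a :: idom mat"
  assumes X: "X \<in> carrier_mat n n" and Y: "Y \<in> carrier_mat l l"
    and C: "C \<in> carrier_mat n l" and Q: "Q \<in> carrier_mat l n"
    and QX: "Q * X = Y * Q"
  shows "det Y * det (X - C * Q) = det X * det (Y - Q * C)"
proof -
  define W where "W = four_block_mat X C Q (1\<^sub>m l)"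
  have W: "W \<in> carrier_mat (n + l) (n + l)"
    using X by (auto simp: W_def)
  \<comment> \<open>The usual eliminating row \<open>(- Q X^-1, 1)\<close> multiplied from the left
    by \<open>Y\<close>: as \<open>Y Q X^-1 = Q\<close>, the inverse disappears, at the cost of the
    factor \<open>det L = det Y\<close>.\<close>
  define L where "L = four_block_mat (1\<^sub>m n) (0\<^sub>m n l) (- Q) Y"
  have L: "L \<in> carrier_mat (n + l) (n + l)"
    using Y by (auto simp: L_def)
  \<comment> \<open>Column operation that uses the identity block of \<open>W\<close> to clear
    \<open>Q\<close>, leaving the Schur complement \<open>X - C * Q\<close>.\<close>
  define R where "R = four_block_mat (1\<^sub>m n) (0\<^sub>m n l) (- Q) (1\<^sub>m l)"
  have R: "R \<in> carrier_mat (n + l) (n + l)"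
    by (auto simp: R_def)
  have CQ: "C * Q \<in> carrier_mat n n" and QC: "Q * C \<in> carrier_mat l l"
    and YQ: "Y * Q \<in> carrier_mat l n"
    using C Q Y by auto
  have "X + C * (- Q) = X - C * Q"
    using X C Q CQ by (auto simp: minus_add_uminus_mat[OF X CQ])
  moreover have "Q + - Q = 0\<^sub>m l n"
    using Q by auto
  ultimately have "W * R = four_block_mat (X - C * Q) C (0\<^sub>m l n) (1\<^sub>m l)"
    unfolding W_def R_def
    by (subst mult_four_block_mat[of _ n n _ l _ l _ _ n _ l]) (use X C Q in auto)
  then have "det (W * R) = det (X - C * Q)"
    by (simp add: det_four_block_mat_lower_left_zero[OF minus_carrier_mat[OF CQ] C refl one_carrier_mat])
  moreover have "det R = 1"
    using Q by (simp add: R_def det_four_block_mat_upper_right_zero[where n = n and m = l])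
  ultimately have 1: "det W = det (X - C * Q)"
    by (simp add: det_mult[OF W R])
  have "- Q * X + Y * Q = 0\<^sub>m l n"
    using X Y Q YQ by (auto simp: QX)
  moreover have "- Q * C + Y = Y - Q * C"
    using Y C Q QC by (auto simp: minus_add_uminus_mat[OF Y QC] comm_add_mat[of _ l l])
  ultimately have "L * W = four_block_mat X C (0\<^sub>m l n) (Y - Q * C)"
    unfolding W_def L_def
    by (subst mult_four_block_mat[of _ n n _ l _ l _ _ n _ l]) (use X Y C Q in auto)
  then have "det (L * W) = det X * det (Y - Q * C)"
    by (simp add: det_four_block_mat_lower_left_zero[OF X C refl minus_carrier_mat[OF QC]])
  moreover have "det L = det Y"
    using Y Q by (simp add: L_def det_four_block_mat_upper_right_zero[where n = n and m = l])
  ultimately show ?thesis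
    by (simp add: det_mult[OF L W] 1)
qed

lemma poly_char_poly:
  fixes A :: "'a :: comm_ring_1 mat"
  assumes "A \<in> carrier_mat n n"
  shows "poly (char_poly A) t = det (t \<cdot>\<^sub>m 1\<^sub>m n - A)"
  unfolding char_poly_defs by (rule poly_det_cong[of _ n]) (use assms in auto)

lemma det_conv_poly_char_poly:
  fixes A :: "'a :: comm_ring_1 mat"
  assumes A: "A \<in> carrier_mat n n"
  shows "det A = (- 1) ^ n * poly (char_poly A) 0"
proof -
  have "0 \<cdot>\<^sub>m 1\<^sub>m n - A = (- 1) \<cdot>\<^sub>m A"
    using A by (intro eq_matI) auto
  then have "poly (char_poly A) 0 = (- 1) ^ n * det A"
    using A by (simp add: poly_char_poly[OF A])
  then show ?thesis
    by (simp flip: mult.assoc power_mult_distrib)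
qed

text \<open>At each point \<open>t\<close> this is \<open>det_intertwine\<close> for
  \<open>t - D\<close> and \<open>t - E\<close>, which are still intertwined because scalars commute
  with \<open>Q\<close>. An integral domain of characteristic 0 is infinite, so agreement at all
  points gives equality of polynomials.\<close>

lemma char_poly_intertwine:
  fixes D :: "'a :: {idom, ring_char_0} mat"
  assumes D: "D \<in> carrier_mat n n" and E: "E \<in> carrier_mat l l"
    and C: "C \<in> carrier_mat n l" and Q: "Q \<in> carrier_mat l n"
    and QD: "Q * D = E * Q"
  shows "char_poly E * char_poly (D + C * Q) = char_poly D * char_poly (E + Q * C)"
proof -
  have "poly (char_poly E * char_poly (D + C * Q)) t
      = poly (char_poly D * char_poly (E + Q * C)) t" for t
  proof -
    let ?X = "t \<cdot>\<^sub>m 1\<^sub>m n - D" and ?Y = "t \<cdot>\<^sub>m 1\<^sub>m l - E"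
    have "Q * ?X = Q * (t \<cdot>\<^sub>m 1\<^sub>m n) - Q * D"
      using Q D by (intro mult_minus_distrib_mat) auto
    also have "\<dots> = (t \<cdot>\<^sub>m 1\<^sub>m l) * Q - E * Q"
      using mult_smult_distrib[OF Q one_carrier_mat, of t] mult_smult_assoc_mat[OF one_carrier_mat Q, of t] Q
      by (simp add: QD)
    also have "\<dots> = ?Y * Q"
      using Q E by (intro minus_mult_distrib_mat[symmetric]) auto
    finally have "det ?Y * det (?X - C * Q) = det ?X * det (?Y - Q * C)"
      using D E C Q by (intro det_intertwine) (auto intro: minus_carrier_mat)
    moreover have "?X - C * Q = t \<cdot>\<^sub>m 1\<^sub>m n - (D + C * Q)"
      using D C Q by (intro eq_matI) auto
    moreover have "?Y - Q * C = t \<cdot>\<^sub>m 1\<^sub>m l - (E + Q * C)"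
      using E C Q by (intro eq_matI) auto
    ultimately show ?thesis
      using D E C Q by (simp add: poly_char_poly[of _ n] poly_char_poly[of _ l])
  qed
  then show ?thesis
    by (simp flip: poly_eq_poly_eq_iff add: fun_eq_iff)
qed

lemma char_poly_mat_diag:
  "char_poly (mat_diag n f) = (\<Prod>i<n. [:- f i, 1:])" for f :: "nat \<Rightarrow> 'a :: idom"
proof -
  have "char_poly (mat_diag n f) = (\<Prod>a \<leftarrow> diag_mat (mat_diag n f). [:- a, 1:])"
    by (rule char_poly_upper_triangular[of _ n]) (auto simp: mat_diag_def)
  also have "diag_mat (mat_diag n f) = map f [0..<n]"
    by (auto simp: diag_mat_def mat_diag_def)
  finally show ?thesis
    by (simp add: o_def prod.list_conv_set_nth atLeast0LessThan)
qed

section \<open>Block coordinates and regrouping by blocks\<close>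

lemma block_offset_0 [simp]: "block_offset d 0 = 0"
  by (simp add: block_offset_def)

lemma block_offset_Suc [simp]: "block_offset d (Suc m) = block_offset d m + d $ m"
  by (simp add: block_offset_def)

lemma less_block_offsetE:
  assumes "k < block_offset d m"
  obtains i r where "i < m" "r < d $ i" "k = block_offset d i + r"
proof -
  have "\<exists>i<m. \<exists>r<d $ i. k = block_offset d i + r"
    using assms
  proof (induction m)
    case (Suc m)
    show ?case
    proof (cases "k < block_offset d m")
      case True
      then show ?thesis
        using Suc.IH less_SucI by blast
    next
      case False
      then have "k - block_offset d m < d $ m" "k = block_offset d m + (k - block_offset d m)"
        using Suc.prems by auto
      then show ?thesis
        by blast
    qed
  qed simp
  then show ?thesis
    using that by blast
qed

lemma block_index_less: "k < block_offset d m \<Longrightarrow> block_index d k < m"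
  by (erule less_block_offsetE) (simp add: block_index_offset_add)

text \<open>Stated for any commutative monoid because it is needed both for a sum (the entries of
  \<open>Q * C\<close>) and for a product (the characteristic polynomial of
  \<open>D\<close>).\<close>

lemma (in comm_monoid_set) block_index_regroup:
  "F (\<lambda>k. g (block_index d k)) {..<block_offset d m}
    = F (\<lambda>i. F (\<lambda>_. g i) {..<d $ i}) {..<m}"
proof (induction m)
  case (Suc m)
  have "F (\<lambda>k. g (block_index d k)) {..<block_offset d (Suc m)}
      = F (\<lambda>k. g (block_index d k)) {..<block_offset d m}
        \<^bold>* F (\<lambda>r. g (block_index d (block_offset d m + r))) {..<d $ m}"
    \<comment> \<open>Split at the start of the last block, then shift that block to start at
      0.\<close>
    using atLeastLessThan_concat[of 0 "block_offset d m" "block_offset d m + d $ m"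
        "\<lambda>k. g (block_index d k)"]
      atLeastLessThan_shift_0[of "\<lambda>k. g (block_index d k)" "block_offset d m"
        "block_offset d m + d $ m"]
    by (simp add: atLeast0LessThan o_def)
  also have "F (\<lambda>r. g (block_index d (block_offset d m + r))) {..<d $ m}
      = F (\<lambda>_. g m) {..<d $ m}"
    by (intro cong) (auto simp: block_index_offset_add)
  finally show ?case
    by (simp add: Suc.IH)
qed simp

lemma diag_block_mat_scalar:
  fixes d :: "nat vec" and f :: "nat \<Rightarrow> 'a :: semiring_1"
  shows "diag_block_mat (map (\<lambda>i. f i \<cdot>\<^sub>m 1\<^sub>m (d $ i)) [0..<m])
    = mat_diag (block_offset d m) (\<lambda>k. f (block_index d k))"
proof (induction m)
  case 0
  then show ?case
    by (auto simp: mat_diag_def)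
next
  case (Suc m)
  let ?n = "block_offset d m"
  have idx: "block_index d k = m" if "?n \<le> k" "k < ?n + d $ m" for k
    using that block_index_offset_add[of "k - ?n" d m] by simp
  show ?case
    by (rule eq_matI) (auto simp: diag_block_mat_last Suc.IH Let_def mat_diag_def idx)
qed

text \<open>The blocks of the first summand are constant, so its entries depend only on the blocks
  of row and column; this makes the factorization \<open>C * Q\<close> possible.\<close>

lemma M_mat_conv:
  "M_mat A lam d =
    mat_diag (block_offset d (dim_vec d)) (\<lambda>k. lam $ block_index d k)
    + mat (block_offset d (dim_vec d)) (block_offset d (dim_vec d))
        (\<lambda>(r, c). A $$ (block_index d r, block_index d c))"
proof -
  let ?n = "block_offset d (dim_vec d)"
  have "block_mat d (\<lambda>i j. A $$ (i, j) \<cdot>\<^sub>m all_ones_mat (d $ i) (d $ j)) $$ (r, c)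
      = A $$ (block_index d r, block_index d c)" if "r < ?n" "c < ?n" for r c
    using that
    by (elim less_block_offsetE) (simp add: block_mat_index block_index_offset_add all_ones_mat_def)
  then show ?thesis
    unfolding M_mat_def diag_block_mat_scalar
    by (intro eq_matI) (auto simp: block_mat_def Let_def mat_diag_def)
qed

section \<open>The characteristic polynomial and the determinant of \<open>M_mat\<close>\<close>

lemma char_poly_M_mat:
  assumes A: "A \<in> carrier_mat (dim_vec d) (dim_vec d)"
    and d: "\<And>i. i < dim_vec d \<Longrightarrow> d $ i > 0"
  shows "char_poly (M_mat A lam d) =
    char_poly (M_bar A lam d) * (\<Prod>i<dim_vec d. [:- lam $ i, 1:] ^ (d $ i - 1))"
proof -
  define l where "l = dim_vec d"
  define n where "n = block_offset d l"
  define D where "D = mat_diag n (\<lambda>k. lam $ block_index d k)"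
  define E where "E = mat_diag l (\<lambda>i. lam $ i)"
  define C where "C = mat n l (\<lambda>(k, j). A $$ (block_index d k, j))"
  define Q :: "complex mat" where "Q = mat l n (\<lambda>(i, k). if block_index d k = i then 1 else 0)"
  have less_l: "block_index d k < l" if "k < n" for k
    using that by (simp add: n_def block_index_less)
  have carrier: "D \<in> carrier_mat n n" "E \<in> carrier_mat l l" "C \<in> carrier_mat n l" "Q \<in> carrier_mat l n"
    by (auto simp: D_def E_def C_def Q_def)
  \<comment> \<open>Column \<open>k\<close> of \<open>Q\<close> is supported in row
    \<open>block_index d k\<close>, where both sides scale it by the same entry of
    \<open>lam\<close>.\<close>
  have "Q * D = E * Q"
    unfolding D_def E_def mat_diag_mult_left[OF carrier(4)] mat_diag_mult_right[OF carrier(4)]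
    by (intro eq_matI) (auto simp: Q_def)
  note main = char_poly_intertwine[OF carrier this]
  \<comment> \<open>In the sum over the inner index only \<open>block_index d c\<close> survives;
    \<open>less_l\<close> puts it in range.\<close>
  have "C * Q = mat n n (\<lambda>(r, c). A $$ (block_index d r, block_index d c))"
    by (intro eq_matI)
      (auto simp: C_def Q_def scalar_prod_def less_l if_distrib[of "\<lambda>x. _ * x"] cong: if_cong)
  then have M: "D + C * Q = M_mat A lam d"
    by (simp add: M_mat_conv D_def n_def l_def)
  have "(Q * C) $$ (i, j) = of_nat (d $ i) * A $$ (i, j)" if "i < l" "j < l" for i j
  proof -
    have "(Q * C) $$ (i, j)
        = (\<Sum>k<n. if block_index d k = i then A $$ (block_index d k, j) else 0)"
      using that by (auto simp: C_def Q_def scalar_prod_def atLeast0LessThan intro!: sum.cong)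
    \<comment> \<open>Rows of \<open>C\<close> agree within a block, so block \<open>i\<close>
      contributes \<open>d $ i\<close> equal terms.\<close>
    also have "\<dots> = (\<Sum>p<l. \<Sum>_<d $ p. if p = i then A $$ (p, j) else 0)"
      unfolding n_def by (rule sum.block_index_regroup)
    also have "\<dots> = of_nat (d $ i) * A $$ (i, j)"
      using that by (simp add: if_distrib[of "\<lambda>x. _ * x"] cong: if_cong)
    finally show ?thesis .
  qed
  then have Mbar: "E + Q * C = M_bar A lam d"
    unfolding M_bar_def mat_diag_mult_left[OF A] E_def
    by (intro eq_matI) (auto simp: l_def mat_diag_def C_def Q_def)
  have E: "char_poly E = (\<Prod>i<l. [:- lam $ i, 1:])"
    by (simp add: E_def char_poly_mat_diag)
  have "char_poly D = (\<Prod>i<l. [:- lam $ i, 1:] ^ d $ i)"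
    using prod.block_index_regroup[of "\<lambda>i. [:- lam $ i, 1:]" d l]
    by (simp add: D_def char_poly_mat_diag n_def)
  \<comment> \<open>Positivity of \<open>d $ i\<close> matters here, since subtraction of naturals
    truncates at 0.\<close>
  also have "\<dots> = (\<Prod>i<l. [:- lam $ i, 1:] ^ (d $ i - 1) * [:- lam $ i, 1:])"
    using d by (intro prod.cong refl power_minus_mult[symmetric]) (auto simp: l_def)
  also have "\<dots> = char_poly E * (\<Prod>i<l. [:- lam $ i, 1:] ^ (d $ i - 1))"
    by (simp only: E prod.distrib mult.commute)
  finally have "char_poly E * char_poly (M_mat A lam d)
      = char_poly E * (char_poly (M_bar A lam d) * (\<Prod>i<l. [:- lam $ i, 1:] ^ (d $ i - 1)))"
    using main by (simp add: M Mbar mult_ac)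
  \<comment> \<open>A product of monic linear factors, so it can be cancelled.\<close>
  moreover have "char_poly E \<noteq> 0"
    by (simp add: E)
  ultimately show ?thesis
    by (simp add: l_def)
qed

theorem theorem2p11:
  fixes l :: nat and A :: "complex mat" and lam :: "complex vec" and d :: "nat vec"
  assumes "A \<in> carrier_mat l l"
    and "lam \<in> carrier_vec l"
    and "d \<in> carrier_vec l"
    and "\<And>i. i < l \<Longrightarrow> d $ i > 0"
  shows "char_poly (M_mat A lam d) =
           char_poly (M_bar A lam d) * (\<Prod>i<l. [:- lam $ i, 1:] ^ (d $ i - 1))
       \<and> det (M_mat A lam d) = det (M_bar A lam d) * (\<Prod>i<l. (lam $ i) ^ (d $ i - 1))"
proof
  have l: "dim_vec d = l"
    using assms by simp
  show char: "char_poly (M_mat A lam d) =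
      char_poly (M_bar A lam d) * (\<Prod>i<l. [:- lam $ i, 1:] ^ (d $ i - 1))"
    using char_poly_M_mat[of A d lam] assms by (simp add: l)
  define n where "n = (\<Sum>i<l. d $ i)"
  have M: "M_mat A lam d \<in> carrier_mat n n"
    using M_mat_carrier[of A lam d] by (simp add: l n_def)
  have Mbar: "M_bar A lam d \<in> carrier_mat l l"
    by (simp add: M_bar_def l)
  \<comment> \<open>Balances the signs at \<open>t = 0\<close>: of \<open>(-1)^n\<close>, the part
    beyond \<open>(-1)^l\<close> cancels against the signs of the factors
    \<open>- lam $ i\<close>.\<close>
  have n: "n = l + (\<Sum>i<l. d $ i - 1)"
  proof -
    have "n = (\<Sum>i<l. 1 + (d $ i - 1))"
      unfolding n_def using assms(4) by (intro sum.cong) fastforce+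
    then show ?thesis
      by (simp only: sum.distrib) simp
  qed
  have "(\<Prod>i<l. (- lam $ i) ^ (d $ i - 1))
      = (- 1) ^ (\<Sum>i<l. d $ i - 1) * (\<Prod>i<l. (lam $ i) ^ (d $ i - 1))"
    by (subst power_sum, subst prod.distrib[symmetric]) (simp flip: power_mult_distrib)
  then have "det (M_mat A lam d) = (- 1) ^ n * poly (char_poly (M_bar A lam d)) 0
      * ((- 1) ^ (\<Sum>i<l. d $ i - 1) * (\<Prod>i<l. (lam $ i) ^ (d $ i - 1)))"
    by (simp add: det_conv_poly_char_poly[OF M] char poly_prod)
  also have "\<dots> = (- 1) ^ l * poly (char_poly (M_bar A lam d)) 0
      * (\<Prod>i<l. (lam $ i) ^ (d $ i - 1))"
    by (simp add: n power_add)
  finally show "det (M_mat A lam d) = det (M_bar A lam d) * (\<Prod>i<l. (lam $ i) ^ (d $ i - 1))"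
    by (simp add: det_conv_poly_char_poly[OF Mbar])
qed

end
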